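(* Let $B$ be either $\mathbb{N}\times\mathbb{N}$ or $\mathbb{Z}\times\mathbb{Z}$. Then the Queen graph on $B$ has no infinite odd independent set.
   Context: Here $\mathbb{N}=\{1,2,3,\ldots\}$. The Queen graph on a board $B\subseteq\mathbb{Z}\times\mathbb{Z}$ has vertex set $B$, and two distinct vertices $(a,b),(a',b')$ are adjacent iff $a=a'$, or $b=b'$, or $a-a'=b-b'$, or $a-a'=b'-b$. For a graph $G=(V,E)$, $N(v)$ denotes the open neighborhood of $v$. A set $S\subseteq V$ is an odd independent set if it is independent (no two of its vertices are adjacent) and, for every vertex $v\in V\setminus S$, the set $N(v)\cap S$ is empty or of odd size. *)

theory Defs
  imports Main
begin

text \<open>
  A simple graph is given by a vertex set \<open>V\<close> and a set \<open>E\<close> of two-element edges.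
\<close>

definition neighborhood :: "'a set \<Rightarrow> 'a set set \<Rightarrow> 'a \<Rightarrow> 'a set" where
  "neighborhood V E v = {u \<in> V. {u, v} \<in> E}"

definition independent_set :: "'a set \<Rightarrow> 'a set set \<Rightarrow> 'a set \<Rightarrow> bool" where
  "independent_set V E S \<longleftrightarrow> S \<subseteq> V \<and> (\<forall>u\<in>S. \<forall>v\<in>S. {u, v} \<notin> E)"

text \<open>
  Since \<open>card A = 0\<close> for infinite \<open>A\<close>, the condition \<open>odd (card A)\<close> entails that \<open>A\<close> is finite.
\<close>

definition odd_independent_set :: "'a set \<Rightarrow> 'a set set \<Rightarrow> 'a set \<Rightarrow> bool" where
  "odd_independent_set V E S \<longleftrightarrow>
     independent_set V E S \<and>
     (\<forall>v\<in>V - S. neighborhood V E v \<inter> S = {} \<or> odd (card (neighborhood V E v \<inter> S)))"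

fun queen_adjacent :: "int \<times> int \<Rightarrow> int \<times> int \<Rightarrow> bool" where
  "queen_adjacent (a, b) (a', b') \<longleftrightarrow>
     (a, b) \<noteq> (a', b') \<and> (a = a' \<or> b = b' \<or> a - a' = b - b' \<or> a - a' = b' - b)"

definition queen_edges :: "(int \<times> int) set \<Rightarrow> (int \<times> int) set set" where
  "queen_edges B = {{p, q} | p q. p \<in> B \<and> q \<in> B \<and> queen_adjacent p q}"

end

theory Submission
  imports Defs
begin

text \<open>
  Encode \<open>S\<close> by the indicators \<open>c\<close>, \<open>r\<close>, \<open>d\<close>, \<open>a\<close> of the columns, rows, diagonals and antidiagonals
  that it meets. A vertex outside \<open>S\<close> lies on 0, 1 or 3 such lines, so along an occupied column
  \<open>x\<close> we have \<open>r y = d (x - y) + a (x + y)\<close> modulo 2 for all but one \<open>y\<close>. Comparing three occupied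
  columns and eliminating yields that \<open>a\<close>, \<open>d\<close>, \<open>r\<close> are eventually periodic; rows give the same
  for \<open>c\<close>. Each line meets \<open>S\<close> at most once, so an infinite \<open>S\<close> has a point \<open>(x, y)\<close>
  with \<open>x\<close>, \<open>y\<close>, \<open>x - y\<close>, \<open>x + y\<close> all in the periodic range. Moving it along its column or row by a
  multiple of the period gives a vertex outside \<open>S\<close> on four occupied lines, a contradiction.
\<close>

section \<open>Eventually periodic indicators on the integers\<close>

text \<open>Only the behaviour towards plus infinity is recorded; the other direction is treated by
  reflecting the argument, \<open>t\<close> to \<open>- t\<close>.\<close>

definition evper :: "(int \<Rightarrow> bool) \<Rightarrow> bool" where
  "evper f \<longleftrightarrow> (\<exists>p>0. \<exists>M. \<forall>t\<ge>M. f (t + p) = f t)"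

lemma period_mult:
  fixes f :: "int \<Rightarrow> bool"
  assumes "p > 0" "\<And>t. t \<ge> M \<Longrightarrow> f (t + p) = f t" "t \<ge> M"
  shows "f (t + int k * p) = f t"
proof (induction k)
  case (Suc k)
  have "t + int k * p \<ge> M"
    using assms(1,3) by (simp add: add_increasing2)
  then have "f (t + int k * p + p) = f (t + int k * p)"
    using assms(2) by blast
  then show ?case
    using Suc by (simp add: algebra_simps)
qed simp

text \<open>Multiply the periods and take the maximum of the thresholds. All multiples
  \<open>k\<close> are included because the final shift uses multiples that depend on the chosen
  point.\<close>

lemma finite_common_period:
  assumes "finite F" "\<And>f. f \<in> F \<Longrightarrow> evper f"
  shows "\<exists>p>0. \<exists>M. \<forall>f\<in>F. \<forall>t\<ge>M. \<forall>k. f (t + int k * p) = f t"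
  using assms
proof (induction F rule: finite_induct)
  case empty
  then show ?case by (auto intro: exI[of _ 1])
next
  case (insert g F)
  obtain p M where p: "p > 0" "\<And>f t k. f \<in> F \<Longrightarrow> t \<ge> M \<Longrightarrow> f (t + int k * p) = f t"
    using insert by (metis insertCI)
  obtain q N where q: "q > 0" "\<And>t. t \<ge> N \<Longrightarrow> g (t + q) = g t"
    using insert.prems[of g] unfolding evper_def by auto
  have "f (t + int k * (p * q)) = f t" if "f \<in> insert g F" "t \<ge> max M N" for f t k
  proof (cases "f = g")
    case True
    have "int k * (p * q) = int (k * nat p) * q"
      using p(1) by simp
    moreover have "g (t + int (k * nat p) * q) = g t"
      by (rule period_mult) (use q that in auto)
    ultimately show ?thesis
      using True by metis
  next
    case False
    have "int k * (p * q) = int (k * nat q) * p"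
      using q(1) by simp
    moreover have "f (t + int (k * nat q) * p) = f t"
      by (rule p(2)) (use that False in auto)
    ultimately show ?thesis
      by metis
  qed
  moreover have "p * q > 0"
    using p q by simp
  ultimately show ?case by blast
qed

lemma evper_xor:
  assumes "evper f" "evper g"
  shows "evper (\<lambda>t. f t \<noteq> g t)"
proof -
  obtain p M where p: "p > 0" "\<And>h t k. h \<in> {f, g} \<Longrightarrow> t \<ge> M \<Longrightarrow> h (t + int k * p) = h t"
    using finite_common_period[of "{f, g}"] assms by (metis finite.emptyI finite.insertI insertE singletonD)
  have "\<forall>t\<ge>M. (f (t + p) \<noteq> g (t + p)) = (f t \<noteq> g t)"
    using p(2)[of f _ 1] p(2)[of g _ 1] by simp
  with p(1) show ?thesis
    unfolding evper_def by blast
qed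

lemma evper_cong:
  assumes "evper f" "\<And>t. t \<ge> M \<Longrightarrow> g t = f t"
  shows "evper g"
proof -
  obtain p N where p: "p > 0" "\<And>t. t \<ge> N \<Longrightarrow> f (t + p) = f t"
    using assms(1) unfolding evper_def by auto
  have "\<forall>t\<ge>max M N. g (t + p) = g t"
    using p assms(2) by simp
  with p(1) show ?thesis
    unfolding evper_def by blast
qed

lemma evper_shift: "evper f \<Longrightarrow> evper (\<lambda>t. f (t + s))"
proof -
  assume "evper f"
  then obtain p N where p: "p > 0" "\<And>t. t \<ge> N \<Longrightarrow> f (t + p) = f t"
    unfolding evper_def by auto
  have "\<forall>t\<ge>N - s. f (t + p + s) = f (t + s)"
    using p(2)[of "_ + s"] by (simp add: algebra_simps)
  with p(1) show ?thesis
    unfolding evper_def by blast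
qed

lemma evper_shiftD: "evper (\<lambda>t. f (t + s)) \<Longrightarrow> evper f"
  using evper_shift[of "\<lambda>t. f (t + s)" "-s"] by simp

lemma evper_eventually_false: "(\<And>t. t \<ge> M \<Longrightarrow> \<not> f t) \<Longrightarrow> evper f"
  unfolding evper_def by (intro exI[of _ 1] conjI exI[of _ M]) auto

text \<open>
  Over the field with two elements, with shift operator \<open>T\<close>: \<open>T^p - 1\<close> and \<open>T^q - 1\<close> both divide
  \<open>T^(p q) - 1\<close>, whose square is \<open>T^(2 p q) - 1\<close>.
\<close>

lemma evper_of_difference:
  assumes "q > 0" "evper (\<lambda>t. g t \<noteq> g (t + q))"
  shows "evper g"
proof -
  let ?w = "\<lambda>t. g t \<noteq> g (t + q)"
  obtain p M where p: "p > 0" "\<And>t. t \<ge> M \<Longrightarrow> ?w (t + p) = ?w t"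
    using assms(2) unfolding evper_def by blast
  let ?n = "p * q"
  have n: "?n > 0"
    using p assms by simp
  have w: "?w (t + ?n) = ?w t" if "t \<ge> M" for t
    using period_mult[of p M ?w t "nat q"] p that assms(1) by (simp add: mult.commute)
  let ?z = "\<lambda>t. g t \<noteq> g (t + ?n)"
  have "?z (t + q) = ?z t" if "t \<ge> M" for t
    using w[OF that] by (auto simp: algebra_simps)
  then have "?z (t + ?n) = ?z t" if "t \<ge> M" for t
    using period_mult[of q M ?z t "nat p"] p that assms(1) by simp
  then have "\<forall>t\<ge>M. g (t + 2 * ?n) = g t"
    by (auto simp: algebra_simps)
  then show ?thesis
    unfolding evper_def using n by (intro exI[of _ "2 * ?n"]) auto
qed

text \<open>Two values \<open>x < x'\<close> of \<open>X\<close> eliminate \<open>f\<close> and show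
  that \<open>h t + g (t + x) + g (t + x')\<close> modulo 2 has eventual period
  \<open>x' - x\<close>. Adding two such sums that share \<open>x1\<close> cancels \<open>h\<close>
  and leaves a difference of \<open>g\<close> with step \<open>x3 - x2\<close>, so \<open>g\<close>
  is eventually periodic; \<open>h\<close> and then \<open>f\<close> follow.\<close>

lemma evper_of_xor_relation:
  fixes f g h :: "int \<Rightarrow> bool"
  assumes "infinite X"
    and rel: "\<And>x. x \<in> X \<Longrightarrow> \<exists>M. \<forall>y\<ge>M. h y = (f (y - x) \<noteq> g (y + x))"
  shows "evper f" "evper g" "evper h"
proof -
  obtain Y where Y: "Y \<subseteq> X" "finite Y" "card Y = 3"
    using infinite_arbitrarily_large[OF assms(1)] by blast
  have "\<exists>x1 x2 x3. x1 \<in> X \<and> x2 \<in> X \<and> x3 \<in> X \<and> x1 < x2 \<and> x2 < x3"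
  proof -
    from Y(3) obtain u v w where "Y = {u, v, w}" "u \<noteq> v" "u \<noteq> w" "v \<noteq> w"
      by (auto simp: card_3_iff)
    with Y(1) show ?thesis
      by (metis insert_subset linorder_neqE)
  qed
  then obtain x1 x2 x3 where x: "x1 \<in> X" "x2 \<in> X" "x3 \<in> X" "x1 < x2" "x2 < x3"
    by blast
  have f_eq: "\<exists>M. \<forall>t\<ge>M. f t = (g (t + 2 * x) \<noteq> h (t + x))" if x: "x \<in> X" for x
  proof -
    obtain M where M: "\<And>y. y \<ge> M \<Longrightarrow> h y = (f (y - x) \<noteq> g (y + x))"
      using rel[OF x] by blast
    have "\<forall>t\<ge>M - x. f t = (g (t + 2 * x) \<noteq> h (t + x))"
      using M[of "_ + x"] by (auto simp: algebra_simps)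
    then show ?thesis by blast
  qed
  have u: "evper (\<lambda>t. h t \<noteq> (g (t + x) \<noteq> g (t + x')))" if x: "x \<in> X" "x' \<in> X" "x < x'" for x x'
  proof -
    let ?u = "\<lambda>t. h t \<noteq> (g (t + x) \<noteq> g (t + x'))"
    obtain M where M: "\<And>t. t \<ge> M \<Longrightarrow> f t = (g (t + 2 * x) \<noteq> h (t + x))"
      using f_eq x by blast
    obtain M' where M': "\<And>t. t \<ge> M' \<Longrightarrow> f t = (g (t + 2 * x') \<noteq> h (t + x'))"
      using f_eq x by blast
    have "?u (t + (x' - x)) = ?u t" if "t \<ge> max M M' + x" for t
    proof -
      \<comment> \<open>Both sides equal \<open>f (t - x)\<close>. Adding \<open>g (t + x')\<close>
        to each turns them into \<open>?u t\<close> and \<open>?u (t + (x' - x))\<close>.\<close>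
      have "(g (t + x) \<noteq> h t) = (g (t - x + 2 * x') \<noteq> h (t - x + x'))"
        using M[of "t - x"] M'[of "t - x"] that by (simp add: algebra_simps)
      then show ?thesis
        by (auto simp: algebra_simps)
    qed
    then show ?thesis
      unfolding evper_def using x(3) by (intro exI[of _ "x' - x"]) auto
  qed
  have "evper (\<lambda>t. (h t \<noteq> (g (t + x1) \<noteq> g (t + x2))) \<noteq> (h t \<noteq> (g (t + x1) \<noteq> g (t + x3))))"
    by (rule evper_xor[OF u u]) (use x in auto)
  then have "evper (\<lambda>t. g (t + x2) \<noteq> g (t + x2 + (x3 - x2)))"
    by (rule evper_cong) auto
  then have "evper (\<lambda>t. g t \<noteq> g (t + (x3 - x2)))"
    by (rule evper_shiftD[where s = x2 and f = "\<lambda>t. g t \<noteq> g (t + (x3 - x2))"])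
  then show g: "evper g"
    by (rule evper_of_difference[rotated]) (use x(5) in simp)
  have "evper (\<lambda>t. (h t \<noteq> (g (t + x1) \<noteq> g (t + x2))) \<noteq> (g (t + x1) \<noteq> g (t + x2)))"
    by (rule evper_xor[OF u evper_xor[OF evper_shift[OF g] evper_shift[OF g]]]) (use x in auto)
  then show h: "evper h"
    by (rule evper_cong) auto
  obtain M where "\<And>t. t \<ge> M \<Longrightarrow> f t = (g (t + 2 * x1) \<noteq> h (t + x1))"
    using f_eq x by blast
  then show "evper f"
    by (intro evper_cong[OF evper_xor[OF evper_shift[OF g] evper_shift[OF h]]])
qed

section \<open>Occupied lines through a vertex and their parity\<close>

lemma doubleton_in_queen_edges_iff:
  assumes "u \<in> B" "v \<in> B"
  shows "{u, v} \<in> queen_edges B \<longleftrightarrow> queen_adjacent u v"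
proof -
  have "queen_adjacent p q = queen_adjacent q p" for p q
    by (cases p; cases q) auto
  then show ?thesis
    using assms unfolding queen_edges_def doubleton_eq_iff mem_Collect_eq by blast
qed

text \<open>For each of the four line coordinates this turns the number of points of
  \<open>S\<close> on a line into the indicator of that line.\<close>

lemma card_inj_on_fibre:
  assumes "inj_on l S"
  shows "finite {u \<in> S. l u = t}" "card {u \<in> S. l u = t} = of_bool (t \<in> l ` S)"
proof -
  have "finite {u \<in> S. l u = t} \<and> card {u \<in> S. l u = t} = of_bool (t \<in> l ` S)"
  proof (cases "t \<in> l ` S")
    case True
    then obtain v where "v \<in> S" "t = l v"
      by blast
    then have "{u \<in> S. l u = t} = {v}"
      using assms unfolding inj_on_def by blast
    with True show ?thesis
      by simp
  next
    case False
    then have empty: "{u \<in> S. l u = t} = {}"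
      by blast
    show ?thesis
      unfolding empty using False by simp
  qed
  then show "finite {u \<in> S. l u = t}" "card {u \<in> S. l u = t} = of_bool (t \<in> l ` S)"
    by blast+
qed

lemma finite_inj_on_bounded:
  fixes l :: "'a \<Rightarrow> int"
  assumes "inj_on l S"
  shows "finite {u \<in> S. \<bar>l u\<bar> < M}"
proof (rule finite_imageD)
  show "finite (l ` {u \<in> S. \<bar>l u\<bar> < M})"
    by (rule finite_subset[of _ "{-M..M}"]) auto
  show "inj_on l {u \<in> S. \<bar>l u\<bar> < M}"
    using assms by (auto intro: inj_on_subset)
qed

abbreviation diag :: "int \<times> int \<Rightarrow> int" where
  "diag u \<equiv> fst u - snd u"

abbreviation antidiag :: "int \<times> int \<Rightarrow> int" where
  "antidiag u \<equiv> fst u + snd u"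

context
  fixes B S :: "(int \<times> int) set"
  assumes odd_ind: "odd_independent_set B (queen_edges B) S"
begin

lemma S_subset: "S \<subseteq> B"
  using odd_ind unfolding odd_independent_set_def independent_set_def by blast

lemma inj_on_lines: "inj_on fst S" "inj_on snd S" "inj_on diag S" "inj_on antidiag S"
proof -
  have "\<not> queen_adjacent u v" if "u \<in> S" "v \<in> S" for u v
    using odd_ind that doubleton_in_queen_edges_iff[of u B v]
    unfolding odd_independent_set_def independent_set_def by blast
  then show "inj_on fst S" "inj_on snd S" "inj_on diag S" "inj_on antidiag S"
    unfolding inj_on_def by (force simp: algebra_simps)+
qed

text \<open>The four lines through \<open>(x, y)\<close> meet pairwise only in
  \<open>(x, y)\<close>, which is not in \<open>S\<close>; so their traces on \<open>S\<close> are
  disjoint and the counts add up.\<close>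

lemma card_neighborhood_Int:
  assumes "(x, y) \<in> B - S"
  shows "card (neighborhood B (queen_edges B) (x, y) \<inter> S) =
    of_bool (x \<in> fst ` S) + of_bool (y \<in> snd ` S) +
    of_bool (x - y \<in> diag ` S) + of_bool (x + y \<in> antidiag ` S)"
proof -
  let ?L = "\<lambda>l t. {u \<in> S. l u = t}"
  have "neighborhood B (queen_edges B) (x, y) \<inter> S = {u \<in> S. queen_adjacent u (x, y)}"
    using assms S_subset doubleton_in_queen_edges_iff[of _ B "(x, y)"]
    unfolding neighborhood_def by auto
  also have "{u \<in> S. queen_adjacent u (x, y)} = ?L fst x \<union> ?L snd y \<union> ?L diag (x - y) \<union> ?L antidiag (x + y)"
    using assms by (auto simp: algebra_simps)
  finally have N_eq: "neighborhood B (queen_edges B) (x, y) \<inter> S =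
      ?L fst x \<union> ?L snd y \<union> ?L diag (x - y) \<union> ?L antidiag (x + y)" .
  have "card (?L fst x \<union> ?L snd y \<union> ?L diag (x - y) \<union> ?L antidiag (x + y)) =
      card (?L fst x) + card (?L snd y) + card (?L diag (x - y)) + card (?L antidiag (x + y))"
  proof -
    note fin = inj_on_lines[THEN card_inj_on_fibre(1)]
    have "?L fst x \<inter> ?L snd y = {}" "(?L fst x \<union> ?L snd y) \<inter> ?L diag (x - y) = {}"
      "(?L fst x \<union> ?L snd y \<union> ?L diag (x - y)) \<inter> ?L antidiag (x + y) = {}"
    proof -
      have "(x', y') \<noteq> (x, y)" if "(x', y') \<in> S" for x' y'
        using that assms by auto
      then show "?L fst x \<inter> ?L snd y = {}" "(?L fst x \<union> ?L snd y) \<inter> ?L diag (x - y) = {}"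
        "(?L fst x \<union> ?L snd y \<union> ?L diag (x - y)) \<inter> ?L antidiag (x + y) = {}"
        by fastforce+
    qed
    with fin show ?thesis
      by (simp add: card_Un_disjoint)
  qed
  then show ?thesis
    unfolding N_eq inj_on_lines[THEN card_inj_on_fibre(2)] .
qed

lemma odd_sum_of_bool_iff:
  "odd (of_bool P + of_bool Q + of_bool P' + of_bool Q' :: nat) \<longleftrightarrow> (P \<noteq> Q) \<noteq> (P' \<noteq> Q')"
  by (cases P; cases Q; cases P'; cases Q') simp_all

text \<open>An occupied line through the vertex rules out an empty neighborhood in \<open>S\<close>,
  so the number of occupied lines is odd.\<close>

lemma parity_of_lines:
  assumes "(x, y) \<in> B - S"
    and "x \<in> fst ` S \<or> y \<in> snd ` S \<or> x - y \<in> diag ` S \<or> x + y \<in> antidiag ` S"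
  shows "((x \<in> fst ` S) \<noteq> (y \<in> snd ` S)) \<noteq> ((x - y \<in> diag ` S) \<noteq> (x + y \<in> antidiag ` S))"
proof -
  let ?N = "neighborhood B (queen_edges B) (x, y) \<inter> S"
  have "?N = {} \<or> odd (card ?N)"
    using odd_ind assms(1) unfolding odd_independent_set_def by blast
  moreover have "card ?N \<noteq> 0"
    using card_neighborhood_Int[OF assms(1)] assms(2) by auto
  ultimately have "odd (card ?N)"
    by (metis card.empty)
  then show ?thesis
    unfolding card_neighborhood_Int[OF assms(1)] odd_sum_of_bool_iff .
qed

text \<open>The exception \<open>s\<close> is the height of the point of \<open>S\<close> in column
  \<open>x\<close>. At any other height the vertex lies outside \<open>S\<close>, and the occupied
  column contributes the constant 1 to the odd sum.\<close>

lemma column_relation: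
  assumes "x \<in> fst ` S"
  obtains s where "\<And>y. (x, y) \<in> B \<Longrightarrow> y \<noteq> s \<Longrightarrow>
    (y \<in> snd ` S) = ((x - y \<in> diag ` S) \<noteq> (x + y \<in> antidiag ` S))"
proof -
  obtain s where s: "(x, s) \<in> S"
    using assms by auto
  have "(y \<in> snd ` S) = ((x - y \<in> diag ` S) \<noteq> (x + y \<in> antidiag ` S))"
    if "(x, y) \<in> B" "y \<noteq> s" for y
  proof -
    have "(x, y) \<notin> S"
      using s that inj_onD[OF inj_on_lines(1), of "(x, y)" "(x, s)"] by auto
    then show ?thesis
      using parity_of_lines[of x y] assms that by blast
  qed
  then show thesis
    by (rule that)
qed

lemma row_relation:
  assumes "y \<in> snd ` S"
  obtains s where "\<And>x. (x, y) \<in> B \<Longrightarrow> x \<noteq> s \<Longrightarrow>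
    (x \<in> fst ` S) = ((x - y \<in> diag ` S) \<noteq> (x + y \<in> antidiag ` S))"
proof -
  obtain s where s: "(s, y) \<in> S"
    using assms by auto
  have "(x \<in> fst ` S) = ((x - y \<in> diag ` S) \<noteq> (x + y \<in> antidiag ` S))"
    if "(x, y) \<in> B" "x \<noteq> s" for x
  proof -
    have "(x, y) \<notin> S"
      using s that inj_onD[OF inj_on_lines(2), of "(x, y)" "(s, y)"] by auto
    then show ?thesis
      using parity_of_lines[of x y] assms that by blast
  qed
  then show thesis
    by (rule that)
qed

lemma not_all_lines_occupied:
  assumes "(x, y) \<in> B - S"
  shows "\<not> (x \<in> fst ` S \<and> y \<in> snd ` S \<and> x - y \<in> diag ` S \<and> x + y \<in> antidiag ` S)"
proof
  assume "x \<in> fst ` S \<and> y \<in> snd ` S \<and> x - y \<in> diag ` S \<and> x + y \<in> antidiag ` S"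
  with parity_of_lines[OF assms] show False
    by simp
qed

section \<open>Periodicity of the line indicators in each direction\<close>

text \<open>Going up column \<open>x\<close>, the diagonal coordinate
  \<open>x - y = - (y - x)\<close> decreases, hence the reflected indicator for diagonals.
  Infinitely many columns are occupied since each meets \<open>S\<close> at most once.\<close>

lemma evper_lines_upward:
  assumes "infinite S"
    and up: "\<And>x y y'. (x, y) \<in> S \<Longrightarrow> y \<le> y' \<Longrightarrow> (x, y') \<in> B"
  shows "evper (\<lambda>t. - t \<in> diag ` S)" "evper (\<lambda>t. t \<in> antidiag ` S)" "evper (\<lambda>t. t \<in> snd ` S)"
proof -
  have inf: "infinite (fst ` S)"
    using assms(1) inj_on_lines(1) by (simp add: finite_image_iff)
  have "\<exists>M. \<forall>y\<ge>M. (y \<in> snd ` S) = ((- (y - x) \<in> diag ` S) \<noteq> (y + x \<in> antidiag ` S))"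
    if x: "x \<in> fst ` S" for x
  proof -
    obtain s where s: "\<And>y. (x, y) \<in> B \<Longrightarrow> y \<noteq> s \<Longrightarrow>
      (y \<in> snd ` S) = ((x - y \<in> diag ` S) \<noteq> (x + y \<in> antidiag ` S))"
      using column_relation[OF x] by blast
    obtain b where "(x, b) \<in> S"
      using x by auto
    \<comment> \<open>From height \<open>b\<close> on, \<open>up\<close> keeps the column inside
      \<open>B\<close>; from \<open>s + 1\<close> on, the exceptional height has been
      passed.\<close>
    then have "\<forall>y\<ge>max b (s + 1).
      (y \<in> snd ` S) = ((- (y - x) \<in> diag ` S) \<noteq> (y + x \<in> antidiag ` S))"
      using s up by (simp add: add.commute)
    then show ?thesis by blast
  qed
  note evper = evper_of_xor_relation[of "fst ` S" "\<lambda>t. t \<in> snd ` S" "\<lambda>t. - t \<in> diag ` S"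
      "\<lambda>t. t \<in> antidiag ` S", OF inf this]
  show "evper (\<lambda>t. - t \<in> diag ` S)"
    by (rule evper(1))
  show "evper (\<lambda>t. t \<in> antidiag ` S)"
    by (rule evper(2))
  show "evper (\<lambda>t. t \<in> snd ` S)"
    by (rule evper(3))
qed

lemma evper_lines_rightward:
  assumes "infinite S"
    and right: "\<And>x y x'. (x, y) \<in> S \<Longrightarrow> x \<le> x' \<Longrightarrow> (x', y) \<in> B"
  shows "evper (\<lambda>t. t \<in> diag ` S)" "evper (\<lambda>t. t \<in> fst ` S)"
proof -
  have inf: "infinite (snd ` S)"
    using assms(1) inj_on_lines(2) by (simp add: finite_image_iff)
  have "\<exists>M. \<forall>x\<ge>M. (x \<in> fst ` S) = ((x - y \<in> diag ` S) \<noteq> (x + y \<in> antidiag ` S))"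
    if y: "y \<in> snd ` S" for y
  proof -
    obtain s where s: "\<And>x. (x, y) \<in> B \<Longrightarrow> x \<noteq> s \<Longrightarrow>
      (x \<in> fst ` S) = ((x - y \<in> diag ` S) \<noteq> (x + y \<in> antidiag ` S))"
      using row_relation[OF y] by blast
    obtain b where "(b, y) \<in> S"
      using y by auto
    then have "\<forall>x\<ge>max b (s + 1).
      (x \<in> fst ` S) = ((x - y \<in> diag ` S) \<noteq> (x + y \<in> antidiag ` S))"
      using s right by simp
    then show ?thesis by blast
  qed
  note evper = evper_of_xor_relation[of "snd ` S" "\<lambda>t. t \<in> fst ` S" "\<lambda>t. t \<in> diag ` S"
      "\<lambda>t. t \<in> antidiag ` S", OF inf this]
  show "evper (\<lambda>t. t \<in> diag ` S)"
    by (rule evper(1))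
  show "evper (\<lambda>t. t \<in> fst ` S)"
    by (rule evper(3))
qed

text \<open>Replacing \<open>y\<close> by \<open>- y\<close> in the column relation exchanges the
  roles of diagonals and antidiagonals.\<close>

lemma evper_lines_downward:
  assumes "infinite S" "B = UNIV"
  shows "evper (\<lambda>t. - t \<in> antidiag ` S)" "evper (\<lambda>t. - t \<in> snd ` S)"
proof -
  have inf: "infinite (fst ` S)"
    using assms(1) inj_on_lines(1) by (simp add: finite_image_iff)
  have "\<exists>M. \<forall>y\<ge>M. (- y \<in> snd ` S) = ((- (y - x) \<in> antidiag ` S) \<noteq> (y + x \<in> diag ` S))"
    if x: "x \<in> fst ` S" for x
  proof -
    obtain s where s: "\<And>y. (x, y) \<in> B \<Longrightarrow> y \<noteq> s \<Longrightarrow>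
      (y \<in> snd ` S) = ((x - y \<in> diag ` S) \<noteq> (x + y \<in> antidiag ` S))"
      using column_relation[OF x] by blast
    have "(- y \<in> snd ` S) = ((- (y - x) \<in> antidiag ` S) \<noteq> (y + x \<in> diag ` S))"
      if "y \<ge> 1 - s" for y
    proof -
      have "- y \<noteq> s" using that by simp
      then show ?thesis
        using s[of "- y"] assms(2) by (auto simp: add.commute simp del: image_iff)
    qed
    then show ?thesis by blast
  qed
  note evper = evper_of_xor_relation[of "fst ` S" "\<lambda>t. - t \<in> snd ` S" "\<lambda>t. - t \<in> antidiag ` S"
      "\<lambda>t. t \<in> diag ` S", OF inf this]
  show "evper (\<lambda>t. - t \<in> antidiag ` S)"
    by (rule evper(1))
  show "evper (\<lambda>t. - t \<in> snd ` S)"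
    by (rule evper(3))
qed

lemma evper_lines_leftward:
  assumes "infinite S" "B = UNIV"
  shows "evper (\<lambda>t. - t \<in> fst ` S)"
proof -
  have inf: "infinite (snd ` S)"
    using assms(1) inj_on_lines(2) by (simp add: finite_image_iff)
  have rel: "\<exists>M. \<forall>x\<ge>M. (- x \<in> fst ` S) = ((- (x - y) \<in> antidiag ` S) \<noteq> (- (x + y) \<in> diag ` S))"
    if y: "y \<in> snd ` S" for y
  proof -
    obtain s where s: "\<And>x. (x, y) \<in> B \<Longrightarrow> x \<noteq> s \<Longrightarrow>
      (x \<in> fst ` S) = ((x - y \<in> diag ` S) \<noteq> (x + y \<in> antidiag ` S))"
      using row_relation[OF y] by blast
    have "(- x \<in> fst ` S) = ((- (x - y) \<in> antidiag ` S) \<noteq> (- (x + y) \<in> diag ` S))"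
      if "x \<ge> 1 - s" for x
    proof -
      have "- x \<noteq> s" and eqs: "- (x - y) = - x + y" "- (x + y) = - x - y"
        using that by simp_all
      then show ?thesis
        using s[of "- x"] assms(2) unfolding eqs by blast
    qed
    then show ?thesis by blast
  qed
  show ?thesis
    by (rule evper_of_xor_relation(3)[of "snd ` S" "\<lambda>t. - t \<in> fst ` S" "\<lambda>t. - t \<in> antidiag ` S"
      "\<lambda>t. - t \<in> diag ` S", OF inf rel])
qed

section \<open>Shifting a far point of an infinite set\<close>

lemma finite_odd_independent_queen_set:
  assumes "B = {1..} \<times> {1..} \<or> B = UNIV"
  shows "finite S"
proof (rule ccontr)
  assume inf: "infinite S"
  define F where "F = (\<lambda>(l :: int \<times> int \<Rightarrow> int) t. t \<in> l ` S) ` {fst, snd, diag, antidiag} \<union>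
    (\<lambda>(l :: int \<times> int \<Rightarrow> int) t. - t \<in> l ` S) ` {fst, snd, diag, antidiag}"
  have up: "(x, y') \<in> B" if "(x, y) \<in> S" "y \<le> y'" for x y y'
    using assms S_subset that by force
  have right: "(x', y) \<in> B" if "(x, y) \<in> S" "x \<le> x'" for x y x'
    using assms S_subset that by force
  \<comment> \<open>On the quadrant these three coordinates are positive on \<open>S\<close>, so the
    reflected indicators vanish for \<open>t \<ge> 0\<close>. On the full plane they come from the
    downward and leftward relations.\<close>
  have neg: "evper (\<lambda>t. - t \<in> fst ` S) \<and> evper (\<lambda>t. - t \<in> snd ` S) \<and>
    evper (\<lambda>t. - t \<in> antidiag ` S)"
    using assms
  proof
    assume "B = {1..} \<times> {1..}"
    then have "fst u \<ge> 1 \<and> snd u \<ge> 1" if "u \<in> S" for u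
      using S_subset that by auto
    then show ?thesis
      by (intro conjI evper_eventually_false[of 0]) force+
  qed (simp add: evper_lines_downward evper_lines_leftward inf)
  have "finite F"
    unfolding F_def by simp
  moreover have "evper f" if "f \<in> F" for f
    using that neg evper_lines_upward[OF inf up] evper_lines_rightward[OF inf right]
    unfolding F_def by auto
  ultimately obtain p M where p: "p > 0"
    and M: "\<And>f t k. f \<in> F \<Longrightarrow> t \<ge> M \<Longrightarrow> f (t + int k * p) = f t"
    using finite_common_period[of F] by metis
  \<comment> \<open>The shift has the sign of \<open>t\<close>, so the line moves away from 0 and
    stays in the periodic range on its side.\<close>
  have per: "t + k * p \<in> l ` S" if "t \<in> l ` S" "M \<le> \<bar>t\<bar>" "t > 0 \<and> k \<ge> 0 \<or> t < 0 \<and> k \<le> 0"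
    "l \<in> {fst, snd, diag, antidiag}" for l :: "int \<times> int \<Rightarrow> int" and t k
  proof (cases "t > 0")
    case True
    moreover have "(\<lambda>t. t \<in> l ` S) \<in> F"
      using that(4) unfolding F_def by blast
    ultimately show ?thesis
      using M[of "\<lambda>t. t \<in> l ` S" t "nat k"] that by simp
  next
    case False
    moreover have "(\<lambda>t. - t \<in> l ` S) \<in> F"
      using that(4) unfolding F_def by blast
    ultimately show ?thesis
      using M[of "\<lambda>t. - t \<in> l ` S" "- t" "nat (- k)"] that by simp
  qed
  \<comment> \<open>The bound 1 makes all four line coordinates of a far point nonzero: signs are
    defined, \<open>\<bar>x\<bar>\<close> and \<open>\<bar>y\<bar>\<close> differ, and the shifts
    below really move the point.\<close>
  let ?m = "max M 1"
  define near where "near = (\<Union>l\<in>{fst, snd, diag, antidiag}. {u \<in> S. \<bar>l u\<bar> < ?m})"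
  have "finite near"
    unfolding near_def using inj_on_lines[THEN finite_inj_on_bounded] by simp
  then have "infinite (S - near)"
    using inf by (rule Diff_infinite_finite)
  then obtain u where u: "u \<in> S - near"
    using infinite_imp_nonempty by blast
  obtain x y where xy: "u = (x, y)"
    by (cases u)
  have S: "(x, y) \<in> S"
    and far: "\<bar>x\<bar> \<ge> ?m" "\<bar>y\<bar> \<ge> ?m" "\<bar>x - y\<bar> \<ge> ?m" "\<bar>x + y\<bar> \<ge> ?m"
    using u xy unfolding near_def by auto
  have lines: "x \<in> fst ` S" "y \<in> snd ` S" "x - y \<in> diag ` S" "x + y \<in> antidiag ` S"
    using S by force+
  have ne: "\<bar>x\<bar> \<noteq> \<bar>y\<bar>"
    using far by linarith
  show False
  proof (cases "\<bar>x\<bar> < \<bar>y\<bar>")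
    case True
    \<comment> \<open>The coordinate of larger absolute value is moved, with itself as multiplier.
      Here \<open>x + y\<close> has the sign of \<open>y\<close> and \<open>x - y\<close> that of
      \<open>- y\<close>, so all three changing lines move away from 0 as \<open>per\<close>
      requires, while column \<open>x\<close> stays occupied.\<close>
    let ?y = "y + y * p"
    have "y + y * p \<in> snd ` S"
      by (rule per) (use far lines in auto)
    moreover have "(x - y) + (- y) * p \<in> diag ` S"
      by (rule per) (use far lines True in auto)
    moreover have "(x + y) + y * p \<in> antidiag ` S"
      by (rule per) (use far lines True in auto)
    moreover have "(x, ?y) \<in> B"
    proof (cases "y > 0")
      case True
      then show ?thesis using up[OF S] p by simp
    next
      case False
      then have "B = UNIV" using assms S_subset S far by auto
      then show ?thesis by simp
    qed
    moreover have "(x, ?y) \<notin> S"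
      using S inj_onD[OF inj_on_lines(1), of "(x, y)" "(x, ?y)"] p far by auto
    ultimately show False
      using not_all_lines_occupied[of x ?y] lines(1) by (simp add: algebra_simps)
  next
    case False
    \<comment> \<open>Now \<open>x\<close> dominates, so \<open>x - y\<close> and
      \<open>x + y\<close> both have the sign of \<open>x\<close>; row \<open>y\<close> stays
      occupied.\<close>
    let ?x = "x + x * p"
    have "x + x * p \<in> fst ` S"
      by (rule per) (use far lines in auto)
    moreover have "(x - y) + x * p \<in> diag ` S"
      by (rule per) (use far lines False ne in auto)
    moreover have "(x + y) + x * p \<in> antidiag ` S"
      by (rule per) (use far lines False ne in auto)
    moreover have "(?x, y) \<in> B"
    proof (cases "x > 0")
      case True
      then show ?thesis using right[OF S] p by simp
    next
      case False
      then have "B = UNIV" using assms S_subset S far by auto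
      then show ?thesis by simp
    qed
    moreover have "(?x, y) \<notin> S"
      using S inj_onD[OF inj_on_lines(2), of "(x, y)" "(?x, y)"] p far by auto
    ultimately show False
      using not_all_lines_occupied[of ?x y] lines(2) by (simp add: algebra_simps)
  qed
qed

end

theorem theorem11:
  fixes B :: "(int \<times> int) set"
  assumes "B = {1..} \<times> {1..} \<or> B = UNIV"
  shows "\<not> (\<exists>S. odd_independent_set B (queen_edges B) S \<and> infinite S)"
  using finite_odd_independent_queen_set assms by blast

end
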